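(* Let $C_1,C_2,a,c>0$ and $\Omega\in\mathbb{R}$ be constants, let $(x_d,y_d)\in\mathbb{R}^2$, and put $c_1=4!\,c\,a^3C_1$ and $c_2=4!\,c\,a^3C_2$. Consider the time-varying system on $\mathbb{R}^2$ $$ \begin{aligned} \dot{\bar x}&=-\cos(\Omega t)\big(c_1(\bar x-x_d)\cos^3(\Omega t)+c_2(\bar y-y_d)\sin^3(\Omega t)\big),\\ \dot{\bar y}&=-\sin(\Omega t)\big(c_1(\bar x-x_d)\cos^3(\Omega t)+c_2(\bar y-y_d)\sin^3(\Omega t)\big). \end{aligned} $$ Suppose that one of the following conditions is satisfied: (i) $c_1\in(3c_2/5,\,c_2]$ and $\displaystyle \Omega>\frac{2c_1(3c_2-c_1)(2c_2-c_1)}{16c_1^2-(3c_2-c_1)^2}$; (ii) $c_2\in(3c_1/5,\,c_1]$ and $\displaystyle \Omega>\frac{2c_2(3c_1-c_2)(2c_1-c_2)}{16c_2^2-(3c_1-c_2)^2}$. Then the equilibrium $(\bar x,\bar y)=(x_d,y_d)$ of this system is exponentially stable.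
   Context: The system is the third-order Lie bracket system $\dot{\bar X}=[[[g_1,g_2],g_2],g_2]$, with $g_1=cJ(\bar x,\bar y)(\cos\Omega t,\sin\Omega t)^\top$, $g_2=a(\cos\Omega t,\sin\Omega t)^\top$ and objective function $J(x,y)=C_1(x-x_d)^4+C_2(y-y_d)^4$; here $[g_i,g_j]=\frac{\partial g_j}{\partial x}g_i-\frac{\partial g_i}{\partial x}g_j$, with derivatives taken with respect to the state. Equivalently, the common factor in the right-hand sides is $ca^3(J_{\bar x\bar x\bar x}\cos^3(\Omega t)+J_{\bar y\bar y\bar y}\sin^3(\Omega t))$. The constant $\Omega$ is the constant angular velocity of the unicycle. *)

theory Defs
  imports "HOL-Analysis.Analysis"
begin

definition solves_ode_on ::
  "(real \<Rightarrow> 'a \<Rightarrow> 'a) \<Rightarrow> real set \<Rightarrow> (real \<Rightarrow> 'a::real_normed_vector) \<Rightarrow> bool"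
  where "solves_ode_on f I X \<longleftrightarrow>
    (\<forall>t\<in>I. (X has_vector_derivative f t (X t)) (at t within I))"

definition equilibrium :: "(real \<Rightarrow> 'a::real_normed_vector \<Rightarrow> 'a) \<Rightarrow> 'a \<Rightarrow> bool"
  where "equilibrium f xe \<longleftrightarrow> (\<forall>t. f t xe = 0)"

text \<open>
  Exponential stability of an equilibrium of a non-autonomous system. The constants do not depend
  on the initial time. Forward existence of the solutions issuing from the
  \<open>\<delta>\<close>-ball is part of the definition, so the estimate is never vacuous; the estimate
  is required of every such solution, so uniqueness need not be presupposed.
\<close>

definition exponentially_stable :: "(real \<Rightarrow> 'a::real_normed_vector \<Rightarrow> 'a) \<Rightarrow> 'a \<Rightarrow> bool"
  where "exponentially_stable f xe \<longleftrightarrow>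
    equilibrium f xe \<and>
    (\<exists>\<delta>>0. \<exists>M>0. \<exists>\<kappa>>0. \<forall>t0 x0. norm (x0 - xe) < \<delta> \<longrightarrow>
      (\<exists>X. solves_ode_on f {t0..} X \<and> X t0 = x0) \<and>
      (\<forall>X. solves_ode_on f {t0..} X \<and> X t0 = x0 \<longrightarrow>
        (\<forall>t\<ge>t0. norm (X t - xe) \<le> M * norm (x0 - xe) * exp (- \<kappa> * (t - t0)))))"

definition bracket_system ::
  "real \<Rightarrow> real \<Rightarrow> real \<Rightarrow> real \<times> real \<Rightarrow> real \<Rightarrow> real \<times> real \<Rightarrow> real \<times> real"
  where "bracket_system c1 c2 \<Omega> p t = (\<lambda>(x, y).
    (- cos (\<Omega> * t) * (c1 * (x - fst p) * cos (\<Omega> * t) ^ 3 + c2 * (y - snd p) * sin (\<Omega> * t) ^ 3),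
     - sin (\<Omega> * t) * (c1 * (x - fst p) * cos (\<Omega> * t) ^ 3 + c2 * (y - snd p) * sin (\<Omega> * t) ^ 3)))"

end

theory Submission
  imports Defs
begin

text \<open>
  With \<open>\<theta> = \<Omega> t\<close>, write the error in the frame that turns with the vehicle: \<open>r\<close> is its component along
  \<open>(cos \<theta>, sin \<theta>)\<close> and \<open>s\<close> the one along \<open>(- sin \<theta>, cos \<theta>)\<close>. The right-hand side acts along the first
  direction only, so \<open>s' = - \<Omega> r\<close> and \<open>r' = \<Omega> s - (p r + q s)\<close>, with
  \<open>p = c1 cos\<^sup>4 \<theta> + c2 sin\<^sup>4 \<theta>\<close> and \<open>q = cos \<theta> sin \<theta> (c2 sin\<^sup>2 \<theta> - c1 cos\<^sup>2 \<theta>)\<close>. Eliminating \<open>r\<close> gives the damped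
  oscillator \<open>s'' + p s' + (\<Omega>\<^sup>2 - \<Omega> q) s = 0\<close>. Its damping is nonnegative, and its parametric excitation is
  itself a derivative: \<open>4 q\<close> is the derivative of \<open>p\<close> with respect to \<open>\<theta>\<close>.

  The shifted velocity \<open>z = s' + p s / 2\<close> distributes the damping evenly: for \<open>V = \<Omega>\<^sup>2 s\<^sup>2 + z\<^sup>2\<close> one finds
  \<open>V' = - p V + 2 s z (p\<^sup>2 / 4 + 3 \<Omega> q)\<close> (\<open>energy_has_derivative\<close>). Hence \<open>V' \<le> (\<bar>y\<bar> - p) V\<close> with
  \<open>y = p\<^sup>2 / (4 \<Omega>) + 3 q\<close>. The factor \<open>\<bar>y\<bar> - p\<close> need not be negative at every time, but exponential decay
  needs only a negative mean (\<open>gronwall_of_mean_rate\<close>). Replacing \<open>\<bar>y\<bar>\<close> by the quadratic upper bound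
  \<open>y\<^sup>2 / (2 \<mu>) + \<mu> / 2\<close>, where \<open>\<mu>\<close> is the mean of \<open>p\<close>, turns the rate into a trigonometric polynomial, whose
  mean can be computed exactly (\<open>rate_has_negative_mean\<close>): the cross term \<open>p\<^sup>2 q\<close> of \<open>y\<^sup>2\<close> is a derivative
  and averages to zero, and with \<open>\<sigma> = (c1 + c2) / 2\<close> and \<open>d = (c2 - c1) / 2\<close> the mean is negative as soon as
  \<open>\<bar>d\<bar> \<le> \<sigma> / 4\<close> and \<open>9 \<Omega>\<^sup>2 \<ge> \<sigma>\<^sup>2 + 16 d\<^sup>2\<close>.

  This bound is symmetric in \<open>c1\<close> and \<open>c2\<close>. In the variables \<open>\<sigma>\<close> and \<open>d\<close>, the first threshold of the theorem
  is \<open>(\<sigma> - d) (\<sigma> + 2 d) (\<sigma> + 3 d) / (3 \<sigma> (\<sigma> - 4 d))\<close>, which is at least \<open>(\<sigma> + 4 d) / 3\<close>; the second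
  is its mirror image under \<open>d \<mapsto> - d\<close> (\<open>frequency_bound_of_threshold\<close>). Forward existence of
  solutions, which is part of the notion of stability, comes from a contraction argument
  (\<open>global_solution_exists\<close>).
\<close>

section \<open>Global solutions of Lipschitz differential equations\<close>

text \<open>
  In the unknown \<open>Y t = exp (- 2 L (t - t0)) (X t - xe)\<close> the integral equation becomes a fixed-point
  problem for bounded continuous functions: the exponential weight makes the Picard operator a
  contraction by \<open>1 / 2\<close> on the whole half-line at once. The equilibrium \<open>xe\<close> guarantees that the operator
  maps bounded functions to bounded functions.
\<close>
lemma global_solution_exists:
  fixes f :: "real \<Rightarrow> 'a::banach \<Rightarrow> 'a"
  assumes cont: "continuous_on UNIV (\<lambda>(t, x). f t x)"
    and lip: "\<And>t x y. norm (f t x - f t y) \<le> L * norm (x - y)"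
    and eq: "\<And>t. f t xe = 0" and "L > 0"
  shows "\<exists>X. solves_ode_on f {t0..} X \<and> X t0 = x0"
proof -
  define G where "G Y t = f t (xe + exp (2 * L * (t - t0)) *\<^sub>R Y t)" for Y :: "real \<Rightarrow> 'a" and t
  \<comment> \<open>Bounded continuous functions live on the whole line, so \<open>\<Phi> Y\<close> is frozen at its initial value
    before \<open>t0\<close>.\<close>
  define \<Phi> where "\<Phi> Y t = exp (- 2 * L * (max t t0 - t0)) *\<^sub>R
      (x0 - xe + integral {t0..max t t0} (G Y))" for Y t
  have contG: "continuous_on S (G Y)" if "continuous_on UNIV Y" for S Y
  proof -
    have "continuous_on S (\<lambda>t. (t, xe + exp (2 * L * (t - t0)) *\<^sub>R Y t))"
      using that by (intro continuous_intros) (auto intro: continuous_on_subset)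
    from continuous_on_compose2[OF cont this] show ?thesis
      by (simp add: G_def[abs_def])
  qed
  have diff: "norm (integral {t0..t} (G Y) - integral {t0..t} (G Z))
        \<le> B / 2 * exp (2 * L * (t - t0))"
    if cY: "continuous_on UNIV Y" and cZ: "continuous_on UNIV Z"
      and B: "\<And>t. norm (Y t - Z t) \<le> B" and "t \<ge> t0" for Y Z B t
  proof -
    have "B \<ge> 0" using B[of 0] norm_ge_zero order_trans by blast
    have int: "G Y integrable_on {t0..t}" "G Z integrable_on {t0..t}"
      using contG cY cZ by (auto intro!: integrable_continuous_real)
    have prim: "((\<lambda>\<tau>. L * (exp (2 * L * (\<tau> - t0)) * B)) has_integral
        (B / 2 * exp (2 * L * (t - t0)) - B / 2 * exp (2 * L * (t0 - t0)))) {t0..t}"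
      using \<open>t \<ge> t0\<close> by (intro fundamental_theorem_of_calculus)
        (auto intro!: derivative_eq_intros simp flip: has_real_derivative_iff_has_vector_derivative)
    have "integral {t0..t} (G Y) - integral {t0..t} (G Z) = integral {t0..t} (\<lambda>\<tau>. G Y \<tau> - G Z \<tau>)"
      using int by (simp add: Henstock_Kurzweil_Integration.integral_diff)
    also have "norm \<dots> \<le> integral {t0..t} (\<lambda>\<tau>. L * (exp (2 * L * (\<tau> - t0)) * B))"
    proof (rule integral_norm_bound_integral)
      show "(\<lambda>\<tau>. G Y \<tau> - G Z \<tau>) integrable_on {t0..t}"
        using int by (rule integrable_diff)
      show "(\<lambda>\<tau>. L * (exp (2 * L * (\<tau> - t0)) * B)) integrable_on {t0..t}"
        using prim by blast
      fix \<tau>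
      have "norm (G Y \<tau> - G Z \<tau>) \<le> L * norm (exp (2 * L * (\<tau> - t0)) *\<^sub>R (Y \<tau> - Z \<tau>))"
        unfolding G_def using lip[of \<tau> "xe + exp (2 * L * (\<tau> - t0)) *\<^sub>R Y \<tau>"
            "xe + exp (2 * L * (\<tau> - t0)) *\<^sub>R Z \<tau>"]
        by (simp add: scaleR_diff_right)
      also have "\<dots> \<le> L * (exp (2 * L * (\<tau> - t0)) * B)"
        using B[of \<tau>] \<open>L > 0\<close> by (simp add: mult_left_mono)
      finally show "norm (G Y \<tau> - G Z \<tau>) \<le> L * (exp (2 * L * (\<tau> - t0)) * B)" .
    qed
    also have "\<dots> = B / 2 * exp (2 * L * (t - t0)) - B / 2"
      using integral_unique[OF prim] by simp
    also have "\<dots> \<le> B / 2 * exp (2 * L * (t - t0))" using \<open>B \<ge> 0\<close> by simp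
    finally show ?thesis .
  qed
  have der: "((\<lambda>u. integral {t0..u} (G Y)) has_vector_derivative G Y t) (at t within {t0..})"
    if "continuous_on UNIV Y" "t \<ge> t0" for Y t
  proof -
    have "((\<lambda>u. integral {t0..u} (G Y)) has_vector_derivative G Y t) (at t within {t0..t+1})"
      using contG that by (intro integral_has_vector_derivative) auto
    also have "at t within {t0..t+1} = at t within {t0..}"
      by (rule at_within_nhd[of _ "{..<t+1}"]) auto
    finally show ?thesis .
  qed
  have \<Phi>diff: "norm (\<Phi> Y t - \<Phi> Z t) \<le> B / 2"
    if cY: "continuous_on UNIV Y" and cZ: "continuous_on UNIV Z"
      and B: "\<And>t. norm (Y t - Z t) \<le> B" for Y Z B t
  proof -
    have "norm (\<Phi> Y t - \<Phi> Z t) = exp (- 2 * L * (max t t0 - t0)) *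
       norm (integral {t0..max t t0} (G Y) - integral {t0..max t t0} (G Z))"
      unfolding \<Phi>_def by (simp flip: scaleR_diff_right)
    also have "\<dots> \<le> exp (- 2 * L * (max t t0 - t0)) * (B / 2 * exp (2 * L * (max t t0 - t0)))"
      by (intro mult_left_mono diff[OF cY cZ B]) auto
    also have "\<dots> = B / 2" by (simp add: exp_minus)
    finally show ?thesis .
  qed
  have cI: "continuous_on {t0..} (\<lambda>u. integral {t0..u} (G Y))" if "continuous_on UNIV Y" for Y
    using der[OF that] by (auto simp: continuous_on_eq_continuous_within
        intro: has_vector_derivative_continuous)
  have \<Phi>cont: "continuous_on UNIV (\<Phi> Y)" if "continuous_on UNIV Y" for Y
  proof -
    have "continuous_on UNIV (\<lambda>t. integral {t0..max t t0} (G Y))"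
      by (rule continuous_on_compose2[OF cI[OF that]]) (auto intro!: continuous_intros)
    then show ?thesis unfolding \<Phi>_def[abs_def] by (intro continuous_intros)
  qed
  have \<Phi>0: "norm (\<Phi> (\<lambda>_. 0) t) \<le> norm (x0 - xe)" for t
  proof -
    have "G (\<lambda>_. 0) = (\<lambda>_. 0)" by (auto simp: G_def eq)
    then show ?thesis using \<open>L > 0\<close> by (simp add: \<Phi>_def mult_left_le_one_le)
  qed
  have \<Phi>b: "\<Phi> (apply_bcontfun Y) \<in> bcontfun" for Y
  proof (rule bcontfun_normI)
    show "continuous_on UNIV (\<Phi> (apply_bcontfun Y))" by (intro \<Phi>cont) auto
    fix t
    have "norm (\<Phi> Y t - \<Phi> (\<lambda>_. 0) t) \<le> norm Y / 2"
      by (rule \<Phi>diff) (auto intro: norm_bounded)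
    then show "norm (\<Phi> Y t) \<le> norm Y / 2 + norm (x0 - xe)"
      using \<Phi>0[of t] norm_triangle_sub[of "\<Phi> Y t" "\<Phi> (\<lambda>_. 0) t"] by linarith
  qed
  define \<Psi> where "\<Psi> Y = Bcontfun (\<Phi> (apply_bcontfun Y))" for Y
  have \<Psi>: "apply_bcontfun (\<Psi> Y) = \<Phi> (apply_bcontfun Y)" for Y
    unfolding \<Psi>_def using \<Phi>b by (rule Bcontfun_inverse)
  have "dist (\<Psi> Y) (\<Psi> Z) \<le> 1 / 2 * dist Y Z" for Y Z
  proof (rule dist_bound)
    fix t
    have "norm (\<Phi> Y t - \<Phi> Z t) \<le> dist Y Z / 2"
      by (rule \<Phi>diff) (auto simp flip: dist_norm intro: dist_bounded)
    then show "dist (\<Psi> Y t) (\<Psi> Z t) \<le> 1 / 2 * dist Y Z" by (simp add: \<Psi> dist_norm)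
  qed
  then have "\<exists>!Y. \<Psi> Y = Y" by (intro banach_fix_type[of "1 / 2"]) auto
  then obtain Y where "\<Psi> Y = Y" by blast
  then have Y: "apply_bcontfun Y = \<Phi> Y" using \<Psi>[of Y] by simp
  define X where "X t = x0 + integral {t0..t} (G Y)" for t
  have X: "X t = xe + exp (2 * L * (t - t0)) *\<^sub>R Y t" if "t \<ge> t0" for t
  proof -
    have "Y t = exp (- 2 * L * (t - t0)) *\<^sub>R (x0 - xe + integral {t0..t} (G Y))"
      using fun_cong[OF Y, of t] that by (simp add: \<Phi>_def max_absorb1)
    then have "exp (2 * L * (t - t0)) *\<^sub>R Y t = x0 - xe + integral {t0..t} (G Y)"
      by (simp flip: exp_add)
    then show ?thesis by (simp add: X_def)
  qed
  have "solves_ode_on f {t0..} X"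
    unfolding solves_ode_on_def
  proof
    fix t assume "t \<in> {t0..}"
    then have t: "t \<ge> t0" by simp
    have "(X has_vector_derivative G Y t) (at t within {t0..})"
      unfolding X_def[abs_def]
      by (rule has_vector_derivative_eq_rhs, rule has_vector_derivative_add[OF has_vector_derivative_const der])
         (use t in auto)
    moreover have "G Y t = f t (X t)" by (simp add: G_def X[OF t])
    ultimately show "(X has_vector_derivative f t (X t)) (at t within {t0..})" by simp
  qed
  moreover have "X t0 = x0" by (simp add: X_def)
  ultimately show ?thesis by blast
qed

section \<open>Mean values of oscillating functions\<close>

text \<open>
  For a continuous periodic function this is the mean over a period. Phrasing it by a bounded
  primitive of \<open>f - m\<close> avoids integrals over periods, and the bound on the primitive is what yields decay
  constants that do not depend on the initial time.
\<close>
definition has_mean :: "(real \<Rightarrow> real) \<Rightarrow> real \<Rightarrow> bool"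
  where "has_mean f m \<longleftrightarrow>
    (\<exists>F. bounded (range F) \<and> (\<forall>x. (F has_real_derivative f x - m) (at x)))"

lemma has_mean_const: "has_mean (\<lambda>x. c) c"
  unfolding has_mean_def by (intro exI[of _ "\<lambda>x. 0"]) auto

lemma has_mean_add:
  assumes "has_mean f m" "has_mean g n"
  shows "has_mean (\<lambda>x. f x + g x) (m + n)"
proof -
  from assms obtain F G where F: "bounded (range F)" "\<And>x. (F has_real_derivative f x - m) (at x)"
    and G: "bounded (range G)" "\<And>x. (G has_real_derivative g x - n) (at x)"
    unfolding has_mean_def by blast
  have "bounded (range (\<lambda>x. F x + G x))" using F(1) G(1) by (rule bounded_plus_comp)
  moreover have "((\<lambda>x. F x + G x) has_real_derivative f x + g x - (m + n)) (at x)" for x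
    using DERIV_add[OF F(2) G(2), of x] by (simp add: algebra_simps)
  ultimately show ?thesis unfolding has_mean_def by blast
qed

lemma has_mean_scale:
  assumes "has_mean f m"
  shows "has_mean (\<lambda>x. c * f x) (c * m)"
proof -
  from assms obtain F where F: "bounded (range F)" "\<And>x. (F has_real_derivative f x - m) (at x)"
    unfolding has_mean_def by blast
  have "bounded (range (\<lambda>x. c * F x))"
    using bounded_scaleR_comp[OF F(1), of c] by simp
  moreover have "((\<lambda>x. c * F x) has_real_derivative c * f x - c * m) (at x)" for x
    using DERIV_cmult[OF F(2), of c x] by (simp add: algebra_simps)
  ultimately show ?thesis unfolding has_mean_def by blast
qed

lemma has_mean_derivative:
  assumes "\<And>x. (F has_real_derivative f x) (at x)" "bounded (range F)"
  shows "has_mean f 0"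
  using assms unfolding has_mean_def by auto

lemma has_mean_cos_double_power_0: "has_mean (\<lambda>x. cos (2 * x) ^ 0) 1"
  using has_mean_const by simp

lemma has_mean_cos_double_power_1: "has_mean (\<lambda>x. cos (2 * x) ^ 1) 0"
proof (rule has_mean_derivative)
  show "((\<lambda>x. sin (2 * x) / 2) has_real_derivative cos (2 * x) ^ 1) (at x)" for x :: real
    by (auto intro!: derivative_eq_intros)
  show "bounded (range (\<lambda>x. sin (2 * x) / 2 :: real))"
  proof (rule boundedI[of _ 1], clarify)
    show "norm (sin (2 * x) / 2) \<le> 1" for x :: real
      using abs_sin_le_one[of "2 * x"] unfolding real_norm_def by linarith
  qed
qed

text \<open>
  Up to a constant factor, the derivative of \<open>sin (2 x) * cos (2 x) ^ (n + 1)\<close> is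
  \<open>(n + 2) * cos (2 x) ^ (n + 2) - (n + 1) * cos (2 x) ^ n\<close>, so this combination has mean zero.
\<close>
lemma has_mean_cos_double_power_Suc_Suc:
  assumes "has_mean (\<lambda>x. cos (2 * x) ^ n) m"
  shows "has_mean (\<lambda>x. cos (2 * x) ^ (n + 2)) (real (n + 1) / real (n + 2) * m)"
proof -
  have "has_mean (\<lambda>x. cos (2 * x) ^ (n + 2) - real (n + 1) / real (n + 2) * cos (2 * x) ^ n) 0"
  proof (rule has_mean_derivative)
    show "((\<lambda>x. sin (2 * x) * cos (2 * x) ^ (n + 1) / (2 * real (n + 2))) has_real_derivative
        cos (2 * x) ^ (n + 2) - real (n + 1) / real (n + 2) * cos (2 * x) ^ n) (at x)" for x
    proof -
      have s: "sin (2 * x) * sin (2 * x) = 1 - cos (2 * x) * cos (2 * x)"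
        using sin_cos_squared_add[of "2 * x"] unfolding power2_eq_square by linarith
      have "((\<lambda>x. sin (2 * x) * cos (2 * x) ^ (n + 1) / (2 * real (n + 2))) has_real_derivative
          (2 * cos (2 * x) * cos (2 * x) ^ (n + 1)
           - 2 * real (n + 1) * cos (2 * x) ^ n * (sin (2 * x) * sin (2 * x))) / (2 * real (n + 2))) (at x)"
      proof (rule DERIV_cdivide)
        show "((\<lambda>x. sin (2 * x) * cos (2 * x) ^ (n + 1)) has_real_derivative
          (2 * cos (2 * x) * cos (2 * x) ^ (n + 1)
           - 2 * real (n + 1) * cos (2 * x) ^ n * (sin (2 * x) * sin (2 * x)))) (at x)"
          by (rule derivative_eq_intros refl | simp add: algebra_simps)+
      qed
      then show ?thesis
        unfolding s by (rule DERIV_cong) (simp add: field_simps)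
    qed
    show "bounded (range (\<lambda>x. sin (2 * x) * cos (2 * x) ^ (n + 1) / (2 * real (n + 2))))"
    proof (rule boundedI[of _ 1], clarify)
      fix x :: real
      have "\<bar>sin (2 * x)\<bar> * \<bar>cos (2 * x)\<bar> ^ (n + 1) \<le> 1 * 1"
        by (intro mult_mono power_le_one) auto
      then show "norm (sin (2 * x) * cos (2 * x) ^ (n + 1) / (2 * real (n + 2))) \<le> 1"
        by (simp add: abs_mult power_abs divide_le_eq)
    qed
  qed
  from has_mean_add[OF this has_mean_scale[OF assms, of "real (n + 1) / real (n + 2)"]]
  show ?thesis by simp
qed

text \<open>
  A Gronwall estimate with rate \<open>h (\<Omega> t)\<close>. If \<open>H\<close> is the bounded primitive of \<open>h - m\<close>, then multiplying
  \<open>V\<close> by \<open>exp (- H (\<Omega> t) / \<Omega> - m t)\<close> makes it nonincreasing. The constant \<open>K\<close> comes from a bound of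
  \<open>H\<close> alone, hence it is the same for all \<open>V\<close> and all initial times. For \<open>m < 0\<close> this is exponential decay.
\<close>
lemma gronwall_of_mean_rate:
  assumes "has_mean h m" "\<Omega> > 0"
  obtains K where "K > 0" and "\<And>V g t0 t. (\<And>\<tau>. \<tau> \<ge> t0 \<Longrightarrow> (V has_real_derivative g \<tau>) (at \<tau> within {t0..})) \<Longrightarrow>
     (\<And>\<tau>. \<tau> \<ge> t0 \<Longrightarrow> g \<tau> \<le> h (\<Omega> * \<tau>) * V \<tau>) \<Longrightarrow> V t0 \<ge> 0 \<Longrightarrow> t \<ge> t0 \<Longrightarrow>
     V t \<le> K * V t0 * exp (m * (t - t0))"
proof -
  from assms(1) obtain H B where H: "\<And>x. (H has_real_derivative h x - m) (at x)"
    and B: "\<And>x. \<bar>H x\<bar> \<le> B"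
    unfolding has_mean_def bounded_iff by auto
  define E where "E \<tau> = H (\<Omega> * \<tau>) / \<Omega> + m * \<tau>" for \<tau>
  have E': "(E has_real_derivative h (\<Omega> * \<tau>)) (at \<tau> within S)" for \<tau> S
  proof -
    have "((\<lambda>\<tau>. H (\<Omega> * \<tau>)) has_real_derivative (h (\<Omega> * \<tau>) - m) * \<Omega>) (at \<tau> within S)"
      by (rule DERIV_chain2[OF H]) (auto intro!: derivative_eq_intros)
    then show ?thesis
      unfolding E_def using \<open>\<Omega> > 0\<close> by (auto intro!: derivative_eq_intros simp: field_simps)
  qed
  show thesis
  proof (rule that[of "exp (2 * B / \<Omega>)"])
    fix V g :: "real \<Rightarrow> real" and t0 t :: real
    assume V': "\<And>\<tau>. \<tau> \<ge> t0 \<Longrightarrow> (V has_real_derivative g \<tau>) (at \<tau> within {t0..})"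
      and g: "\<And>\<tau>. \<tau> \<ge> t0 \<Longrightarrow> g \<tau> \<le> h (\<Omega> * \<tau>) * V \<tau>" and "V t0 \<ge> 0" "t \<ge> t0"
    define W where "W \<tau> = V \<tau> * exp (- E \<tau>)" for \<tau>
    have W': "(W has_real_derivative (g \<tau> - h (\<Omega> * \<tau>) * V \<tau>) * exp (- E \<tau>)) (at \<tau> within {t0..})"
      if "\<tau> \<ge> t0" for \<tau>
      unfolding W_def using V'[OF that] E'
      by (auto intro!: derivative_eq_intros simp: algebra_simps)
    have "W t \<le> W t0"
    proof (rule DERIV_nonpos_imp_decreasing_open[OF \<open>t \<ge> t0\<close>])
      fix \<tau> assume "t0 < \<tau>"
      then have "at \<tau> within {t0..} = at \<tau>" by (intro at_within_interior) auto
      with W'[of \<tau>] g[of \<tau>] \<open>t0 < \<tau>\<close>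
      show "\<exists>y. (W has_real_derivative y) (at \<tau>) \<and> y \<le> 0"
        by (auto simp: mult_le_0_iff intro!: exI)
    next
      have "continuous_on {t0..} W"
        using W' by (auto simp: continuous_on_eq_continuous_within intro: DERIV_continuous)
      then show "continuous_on {t0..t} W" by (rule continuous_on_subset) auto
    qed
    then have "V t \<le> V t0 * exp (E t - E t0)"
      by (simp add: W_def exp_minus exp_diff field_simps)
    also have "\<dots> \<le> V t0 * exp (2 * B / \<Omega> + m * (t - t0))"
    proof -
      have "H (\<Omega> * t) - H (\<Omega> * t0) \<le> 2 * B" using B[of "\<Omega> * t"] B[of "\<Omega> * t0"] by linarith
      then have "(H (\<Omega> * t) - H (\<Omega> * t0)) / \<Omega> \<le> 2 * B / \<Omega>"
        using \<open>\<Omega> > 0\<close> by (simp add: divide_right_mono)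
      then have "E t - E t0 \<le> 2 * B / \<Omega> + m * (t - t0)"
        by (simp add: E_def diff_divide_distrib algebra_simps)
      then show ?thesis using \<open>V t0 \<ge> 0\<close> by (simp add: mult_left_mono)
    qed
    finally show "V t \<le> exp (2 * B / \<Omega>) * V t0 * exp (m * (t - t0))"
      by (simp add: exp_add mult_ac)
  qed simp
qed

section \<open>The oscillator in the rotating frame and its energy\<close>

text \<open>
  \<open>damping\<close> and \<open>coupling\<close> are the coefficients \<open>p\<close> and \<open>q\<close> in \<open>r' = \<Omega> s - (p r + q s)\<close>.
\<close>
definition damping :: "real \<Rightarrow> real \<Rightarrow> real \<Rightarrow> real"
  where "damping c1 c2 \<theta> = c1 * cos \<theta> ^ 4 + c2 * sin \<theta> ^ 4"

definition coupling :: "real \<Rightarrow> real \<Rightarrow> real \<Rightarrow> real"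
  where "coupling c1 c2 \<theta> = cos \<theta> * sin \<theta> * (c2 * sin \<theta> ^ 2 - c1 * cos \<theta> ^ 2)"

lemma damping_has_derivative_coupling:
  "(damping c1 c2 has_real_derivative 4 * coupling c1 c2 \<theta>) (at \<theta> within S)"
  unfolding damping_def[abs_def] coupling_def
  by (auto intro!: derivative_eq_intros simp: algebra_simps power2_eq_square power3_eq_cube)

lemma damping_double_angle:
  "damping (\<sigma> - d) (\<sigma> + d) \<theta> = (\<sigma> * (1 + cos (2 * \<theta>) ^ 2) - 2 * d * cos (2 * \<theta>)) / 2"
proof -
  have c: "cos \<theta> ^ 2 = (1 + cos (2 * \<theta>)) / 2" by (simp add: cos_double_cos)
  have s: "sin \<theta> ^ 2 = (1 - cos (2 * \<theta>)) / 2" by (simp add: cos_double_sin)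
  have "damping (\<sigma> - d) (\<sigma> + d) \<theta> = (\<sigma> - d) * (cos \<theta> ^ 2) ^ 2 + (\<sigma> + d) * (sin \<theta> ^ 2) ^ 2"
    by (simp add: damping_def flip: power_mult)
  then show ?thesis unfolding c s by (simp add: field_simps power2_eq_square)
qed

lemma coupling_double_angle:
  "coupling (\<sigma> - d) (\<sigma> + d) \<theta> = sin (2 * \<theta>) * (d - \<sigma> * cos (2 * \<theta>)) / 2"
proof -
  have c: "cos \<theta> ^ 2 = (1 + cos (2 * \<theta>)) / 2" by (simp add: cos_double_cos)
  have s: "sin \<theta> ^ 2 = (1 - cos (2 * \<theta>)) / 2" by (simp add: cos_double_sin)
  have "coupling (\<sigma> - d) (\<sigma> + d) \<theta> = sin (2 * \<theta>) / 2 * ((\<sigma> + d) * sin \<theta> ^ 2 - (\<sigma> - d) * cos \<theta> ^ 2)"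
    by (simp add: coupling_def sin_double)
  then show ?thesis unfolding c s by (simp add: field_simps)
qed

lemma abs_damping_le: "\<bar>damping c1 c2 \<theta>\<bar> \<le> \<bar>c1\<bar> + \<bar>c2\<bar>"
proof -
  have "\<bar>c1 * cos \<theta> ^ 4\<bar> \<le> \<bar>c1\<bar> * 1" "\<bar>c2 * sin \<theta> ^ 4\<bar> \<le> \<bar>c2\<bar> * 1"
    unfolding abs_mult power_abs by (intro mult_left_mono power_le_one; simp)+
  then show ?thesis unfolding damping_def by linarith
qed

text \<open>
  Since \<open>- \<Omega> r\<close> is the derivative of \<open>s\<close>, the variable \<open>z\<close> is the shifted velocity \<open>s' + p s / 2\<close>. It satisfies
  \<open>s' = z - p s / 2\<close> and \<open>z' = - p z / 2 + (p\<^sup>2 / 4 + 3 \<Omega> q - \<Omega>\<^sup>2) s\<close>: both variables are damped at the same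
  rate \<open>p / 2\<close>, and the terms in \<open>\<Omega>\<^sup>2 s z\<close> cancel in the derivative of \<open>(\<Omega> s)\<^sup>2 + z\<^sup>2\<close>.
\<close>
lemma energy_has_derivative:
  fixes x y :: "real \<Rightarrow> real" and c1 c2 \<Omega> t :: real
  defines "r \<equiv> \<lambda>t. cos (\<Omega> * t) * x t + sin (\<Omega> * t) * y t"
    and "s \<equiv> \<lambda>t. cos (\<Omega> * t) * y t - sin (\<Omega> * t) * x t"
    and "p \<equiv> \<lambda>t. damping c1 c2 (\<Omega> * t)"
    and "q \<equiv> \<lambda>t. coupling c1 c2 (\<Omega> * t)"
  defines "z \<equiv> \<lambda>t. p t * s t / 2 - \<Omega> * r t"
  defines "w \<equiv> c1 * x t * cos (\<Omega> * t) ^ 3 + c2 * y t * sin (\<Omega> * t) ^ 3"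
  assumes x': "(x has_real_derivative - cos (\<Omega> * t) * w) (at t within S)"
    and y': "(y has_real_derivative - sin (\<Omega> * t) * w) (at t within S)"
  shows "((\<lambda>t. (\<Omega> * s t)\<^sup>2 + (z t)\<^sup>2) has_real_derivative
    - p t * ((\<Omega> * s t)\<^sup>2 + (z t)\<^sup>2) + 2 * s t * z t * ((p t)\<^sup>2 / 4 + 3 * \<Omega> * q t)) (at t within S)"
proof -
  have w: "w = p t * r t + q t * s t"
  proof -
    have "p t * r t + q t * s t = w * (sin (\<Omega> * t) ^ 2 + cos (\<Omega> * t) ^ 2)"
      unfolding p_def q_def r_def s_def w_def damping_def coupling_def by algebra
    then show ?thesis by simp
  qed
  have w_split: "w = w * (cos (\<Omega> * t) * cos (\<Omega> * t)) + w * (sin (\<Omega> * t) * sin (\<Omega> * t))"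
    by (simp flip: distrib_left power2_eq_square)
  have s': "(s has_real_derivative - \<Omega> * r t) (at t within S)"
    unfolding s_def r_def using x' y'
    by (auto intro!: derivative_eq_intros simp: algebra_simps)
  have "(r has_real_derivative \<Omega> * s t - w * (sin (\<Omega> * t) ^ 2 + cos (\<Omega> * t) ^ 2)) (at t within S)"
    unfolding s_def r_def using x' y'
    by (auto intro!: derivative_eq_intros simp: algebra_simps simp flip: w_split)
  then have r': "(r has_real_derivative \<Omega> * s t - (p t * r t + q t * s t)) (at t within S)"
    by (simp add: w)
  have p': "(p has_real_derivative 4 * q t * \<Omega>) (at t within S)"
    unfolding p_def q_def
    by (rule DERIV_chain2[OF damping_has_derivative_coupling]) (auto intro!: derivative_eq_intros)
  have z': "(z has_real_derivative 3 * \<Omega> * q t * s t + p t * \<Omega> * r t / 2 - \<Omega>\<^sup>2 * s t) (at t within S)"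
    unfolding z_def using r' s' p'
    by (auto intro!: derivative_eq_intros simp: field_simps power2_eq_square)
  have "((\<lambda>t. (\<Omega> * s t)\<^sup>2 + (z t)\<^sup>2) has_real_derivative
     2 * \<Omega>\<^sup>2 * s t * (- \<Omega> * r t) + 2 * z t * (3 * \<Omega> * q t * s t + p t * \<Omega> * r t / 2 - \<Omega>\<^sup>2 * s t)) (at t within S)"
    using s' z' by (auto intro!: derivative_eq_intros simp: algebra_simps power2_eq_square)
  moreover have "\<Omega> * r t = p t * s t / 2 - z t" by (simp add: z_def)
  then have "2 * \<Omega>\<^sup>2 * s t * (- \<Omega> * r t) + 2 * z t * (3 * \<Omega> * q t * s t + p t * \<Omega> * r t / 2 - \<Omega>\<^sup>2 * s t)
    = - p t * ((\<Omega> * s t)\<^sup>2 + (z t)\<^sup>2) + 2 * s t * z t * ((p t)\<^sup>2 / 4 + 3 * \<Omega> * q t)"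
    by algebra
  ultimately show ?thesis by simp
qed

text \<open>
  With \<open>y = p\<^sup>2 / (4 \<Omega>) + 3 q\<close> the indefinite term is \<open>2 (\<Omega> s) z y\<close>, which is at most \<open>\<bar>y\<bar>\<close> times the energy. The
  absolute value is then replaced by a parabola touching it at \<open>\<bar>y\<bar> = 3 \<sigma> / 4\<close>, which for the
  coefficient \<open>p\<close> of the system is its mean, so that the rate becomes a trigonometric polynomial.
\<close>
lemma quadratic_rate_bound:
  fixes \<sigma> \<Omega> p q s z :: real
  assumes "\<sigma> > 0" "\<Omega> > 0"
  shows "- p * ((\<Omega> * s)\<^sup>2 + z\<^sup>2) + 2 * s * z * (p\<^sup>2 / 4 + 3 * \<Omega> * q)
    \<le> (3 * \<sigma> / 8 - p + 2 / (3 * \<sigma>) * (p\<^sup>2 / (4 * \<Omega>) + 3 * q)\<^sup>2) * ((\<Omega> * s)\<^sup>2 + z\<^sup>2)"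
proof -
  define y where "y = p\<^sup>2 / (4 * \<Omega>) + 3 * q"
  have "2 * s * z * (p\<^sup>2 / 4 + 3 * \<Omega> * q) = 2 * (\<Omega> * s) * z * y"
    using \<open>\<Omega> > 0\<close> by (simp add: y_def field_simps)
  also have "\<dots> \<le> \<bar>y\<bar> * ((\<Omega> * s)\<^sup>2 + z\<^sup>2)"
  proof -
    have "2 * (\<Omega> * s) * z * y \<le> \<bar>y\<bar> * \<bar>2 * (\<Omega> * s) * z\<bar>"
      by (metis abs_ge_self abs_mult mult.commute)
    moreover have "\<bar>2 * (\<Omega> * s) * z\<bar> \<le> (\<Omega> * s)\<^sup>2 + z\<^sup>2"
      using sum_squares_bound[of "\<bar>\<Omega> * s\<bar>" "\<bar>z\<bar>"] by (simp add: abs_mult power_mult_distrib)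
    then have "\<bar>y\<bar> * \<bar>2 * (\<Omega> * s) * z\<bar> \<le> \<bar>y\<bar> * ((\<Omega> * s)\<^sup>2 + z\<^sup>2)"
      by (rule mult_left_mono) simp
    ultimately show ?thesis by (rule order_trans)
  qed
  also have "\<dots> \<le> (3 * \<sigma> / 8 + 2 / (3 * \<sigma>) * y\<^sup>2) * ((\<Omega> * s)\<^sup>2 + z\<^sup>2)"
  proof (rule mult_right_mono)
    have "0 \<le> (3 * \<sigma> / 4 - \<bar>y\<bar>)\<^sup>2" by simp
    also have "\<dots> = (3 * \<sigma> / 2) * (3 * \<sigma> / 8 + 2 / (3 * \<sigma>) * y\<^sup>2 - \<bar>y\<bar>)"
      using \<open>\<sigma> > 0\<close> by (simp add: power2_diff field_simps power2_eq_square)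
    finally show "\<bar>y\<bar> \<le> 3 * \<sigma> / 8 + 2 / (3 * \<sigma>) * y\<^sup>2"
      using \<open>\<sigma> > 0\<close> by (simp add: zero_le_mult_iff)
  qed simp
  finally show ?thesis by (simp add: y_def algebra_simps)
qed

lemma energy_norm_equivalence:
  fixes p s r \<Omega> P :: real
  assumes "\<bar>p\<bar> \<le> P"
  defines "V \<equiv> (\<Omega> * s)\<^sup>2 + (p * s / 2 - \<Omega> * r)\<^sup>2"
  shows "2 * \<Omega> ^ 4 * (r\<^sup>2 + s\<^sup>2) \<le> (6 * \<Omega>\<^sup>2 + P\<^sup>2) * V"
    and "V \<le> (2 * \<Omega>\<^sup>2 + P\<^sup>2) * (r\<^sup>2 + s\<^sup>2)"
proof -
  define z where "z = p * s / 2 - \<Omega> * r"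
  have V: "V = (\<Omega> * s)\<^sup>2 + z\<^sup>2" by (simp add: V_def z_def)
  have P: "p\<^sup>2 \<le> P\<^sup>2" using assms(1) abs_ge_zero[of p] by (metis power2_abs power_mono)
  have sV: "(\<Omega> * s)\<^sup>2 \<le> V" and zV: "z\<^sup>2 \<le> V" by (simp_all add: V)
  \<comment> \<open>Parallelogram law for \<open>p s / 2\<close> and \<open>z\<close>, whose difference is \<open>\<Omega> r\<close>.\<close>
  have "2 * (\<Omega> * r)\<^sup>2 \<le> 2 * (\<Omega> * r)\<^sup>2 + 2 * (p * s / 2 + z)\<^sup>2" by simp
  also have "\<dots> = p\<^sup>2 * s\<^sup>2 + 4 * z\<^sup>2" by (simp add: z_def power2_eq_square algebra_simps)
  finally have "2 * (\<Omega> * r)\<^sup>2 \<le> p\<^sup>2 * s\<^sup>2 + 4 * z\<^sup>2" .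
  then have "2 * \<Omega> ^ 4 * r\<^sup>2 \<le> p\<^sup>2 * (\<Omega> * s)\<^sup>2 + 4 * \<Omega>\<^sup>2 * z\<^sup>2"
    using mult_left_mono[of "2 * (\<Omega> * r)\<^sup>2" "p\<^sup>2 * s\<^sup>2 + 4 * z\<^sup>2" "\<Omega>\<^sup>2"]
    by (simp add: power_mult_distrib algebra_simps power2_eq_square power4_eq_xxxx)
  also have "\<dots> \<le> P\<^sup>2 * V + 4 * \<Omega>\<^sup>2 * V"
    using P sV zV by (intro add_mono mult_mono) auto
  finally have "2 * \<Omega> ^ 4 * r\<^sup>2 \<le> (4 * \<Omega>\<^sup>2 + P\<^sup>2) * V" by (simp add: algebra_simps)
  moreover have "2 * \<Omega> ^ 4 * s\<^sup>2 \<le> 2 * \<Omega>\<^sup>2 * V"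
    using mult_left_mono[OF sV, of "2 * \<Omega>\<^sup>2"]
    by (simp add: power_mult_distrib algebra_simps power2_eq_square power4_eq_xxxx)
  ultimately show "2 * \<Omega> ^ 4 * (r\<^sup>2 + s\<^sup>2) \<le> (6 * \<Omega>\<^sup>2 + P\<^sup>2) * V"
    by (simp add: algebra_simps)
  have "V \<le> V + (p * s / 2 + \<Omega> * r)\<^sup>2" by simp
  also have "\<dots> = (\<Omega> * s)\<^sup>2 + p\<^sup>2 * s\<^sup>2 / 2 + 2 * \<Omega>\<^sup>2 * r\<^sup>2"
    by (simp add: V_def power2_eq_square field_simps)
  also have "\<dots> \<le> 2 * \<Omega>\<^sup>2 * s\<^sup>2 + P\<^sup>2 * (r\<^sup>2 + s\<^sup>2) + 2 * \<Omega>\<^sup>2 * r\<^sup>2"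
  proof -
    have "p\<^sup>2 * s\<^sup>2 \<le> P\<^sup>2 * s\<^sup>2" using P by (simp add: mult_right_mono)
    moreover have "0 \<le> P\<^sup>2 * r\<^sup>2" "0 \<le> P\<^sup>2 * s\<^sup>2" "0 \<le> \<Omega>\<^sup>2 * s\<^sup>2" by simp_all
    ultimately show ?thesis unfolding power_mult_distrib distrib_left by linarith
  qed
  also have "\<dots> = (2 * \<Omega>\<^sup>2 + P\<^sup>2) * (r\<^sup>2 + s\<^sup>2)" by algebra
  finally show "V \<le> (2 * \<Omega>\<^sup>2 + P\<^sup>2) * (r\<^sup>2 + s\<^sup>2)" .
qed

section \<open>The mean rate of decay\<close>

text \<open>
  Put \<open>u = cos (2 \<theta>)\<close>. Then \<open>p = (\<sigma> (1 + u\<^sup>2) - 2 d u) / 2\<close> has mean \<open>3 \<sigma> / 4\<close>, \<open>q\<^sup>2\<close> and \<open>p\<^sup>4\<close> are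
  polynomials in \<open>u\<close>, and \<open>p\<^sup>2 q\<close> is the derivative of \<open>p\<^sup>3 / 12\<close>. So the mean is negative exactly if the mean
  of \<open>p\<^sup>4 / (16 \<Omega>\<^sup>2) + 9 q\<^sup>2\<close> is below \<open>9 \<sigma>\<^sup>2 / 16\<close>, the square of the mean of \<open>p\<close>, which the lower bound on \<open>\<Omega>\<close>
  ensures.
\<close>
lemma rate_has_negative_mean:
  fixes \<sigma> d \<Omega> :: real
  assumes "\<sigma> > 0" "\<Omega> > 0" and d: "16 * d\<^sup>2 \<le> \<sigma>\<^sup>2" and \<Omega>: "\<sigma>\<^sup>2 + 16 * d\<^sup>2 \<le> 9 * \<Omega>\<^sup>2"
  defines "p \<equiv> damping (\<sigma> - d) (\<sigma> + d)" and "q \<equiv> coupling (\<sigma> - d) (\<sigma> + d)"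
  shows "\<exists>m<0. has_mean (\<lambda>\<theta>. 3 * \<sigma> / 8 - p \<theta> + 2 / (3 * \<sigma>) * ((p \<theta>)\<^sup>2 / (4 * \<Omega>) + 3 * q \<theta>)\<^sup>2) m"
proof -
  note step = has_mean_cos_double_power_Suc_Suc
  have u0: "has_mean (\<lambda>x. cos (2 * x) ^ 0) 1" and u1: "has_mean (\<lambda>x. cos (2 * x) ^ 1) 0"
    by (rule has_mean_cos_double_power_0 has_mean_cos_double_power_1)+
  have u2: "has_mean (\<lambda>x. cos (2 * x) ^ 2) (1 / 2)" using step[OF u0] by (simp add: power2_eq_square)
  have u3: "has_mean (\<lambda>x. cos (2 * x) ^ 3) 0" using step[OF u1] by (simp add: numeral_3_eq_3)
  have u4: "has_mean (\<lambda>x. cos (2 * x) ^ 4) (3 / 8)" using step[OF u2] by simp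
  have u5: "has_mean (\<lambda>x. cos (2 * x) ^ 5) 0" using step[OF u3] by simp
  have u6: "has_mean (\<lambda>x. cos (2 * x) ^ 6) (5 / 16)" using step[OF u4] by simp
  have u7: "has_mean (\<lambda>x. cos (2 * x) ^ 7) 0" using step[OF u5] by simp
  have u8: "has_mean (\<lambda>x. cos (2 * x) ^ 8) (35 / 128)" using step[OF u6] by simp
  note u = u0 u1 u2 u3 u4 u5 u6 u7 u8
  have p_mean: "has_mean p (3 * \<sigma> / 4)"
  proof -
    have "has_mean (\<lambda>x. \<sigma> / 2 * cos (2 * x) ^ 0 + (- d) * cos (2 * x) ^ 1 + \<sigma> / 2 * cos (2 * x) ^ 2)
       (\<sigma> / 2 * 1 + (- d) * 0 + \<sigma> / 2 * (1 / 2))"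
      by (intro has_mean_add has_mean_scale u)
    then show ?thesis
      by (simp add: p_def damping_double_angle[abs_def] algebra_simps add_divide_distrib diff_divide_distrib)
  qed
  have q2_mean: "has_mean (\<lambda>x. (q x)\<^sup>2) (d\<^sup>2 / 8 + \<sigma>\<^sup>2 / 32)"
  proof -
    have "has_mean (\<lambda>x. d\<^sup>2 / 4 * cos (2 * x) ^ 0 + (- (d * \<sigma>) / 2) * cos (2 * x) ^ 1
         + (\<sigma>\<^sup>2 - d\<^sup>2) / 4 * cos (2 * x) ^ 2 + d * \<sigma> / 2 * cos (2 * x) ^ 3 + (- \<sigma>\<^sup>2 / 4) * cos (2 * x) ^ 4)
       (d\<^sup>2 / 4 * 1 + (- (d * \<sigma>) / 2) * 0 + (\<sigma>\<^sup>2 - d\<^sup>2) / 4 * (1 / 2) + d * \<sigma> / 2 * 0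
         + (- \<sigma>\<^sup>2 / 4) * (3 / 8))"
      by (intro has_mean_add has_mean_scale u)
    moreover have "(q x)\<^sup>2 = d\<^sup>2 / 4 * cos (2 * x) ^ 0 + (- (d * \<sigma>) / 2) * cos (2 * x) ^ 1
         + (\<sigma>\<^sup>2 - d\<^sup>2) / 4 * cos (2 * x) ^ 2 + d * \<sigma> / 2 * cos (2 * x) ^ 3 + (- \<sigma>\<^sup>2 / 4) * cos (2 * x) ^ 4" for x
    proof -
      have "(q x)\<^sup>2 = (1 - cos (2 * x) ^ 2) * (d - \<sigma> * cos (2 * x)) ^ 2 / 4"
        by (simp add: q_def coupling_double_angle power_mult_distrib power_divide flip: sin_squared_eq)
      also have "\<dots> = d\<^sup>2 / 4 * cos (2 * x) ^ 0 + (- (d * \<sigma>) / 2) * cos (2 * x) ^ 1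
         + (\<sigma>\<^sup>2 - d\<^sup>2) / 4 * cos (2 * x) ^ 2 + d * \<sigma> / 2 * cos (2 * x) ^ 3 + (- \<sigma>\<^sup>2 / 4) * cos (2 * x) ^ 4"
        by (simp add: field_simps power2_eq_square power3_eq_cube power4_eq_xxxx)
      finally show ?thesis .
    qed
    moreover have "d\<^sup>2 / 4 * 1 + (- (d * \<sigma>) / 2) * 0 + (\<sigma>\<^sup>2 - d\<^sup>2) / 4 * (1 / 2) + d * \<sigma> / 2 * 0
         + (- \<sigma>\<^sup>2 / 4) * (3 / 8) = d\<^sup>2 / 8 + \<sigma>\<^sup>2 / 32"
      by (simp add: field_simps)
    ultimately show ?thesis by (simp only:)
  qed
  define M where "M = (867 / 128 * \<sigma> ^ 4 + 75 / 2 * \<sigma>\<^sup>2 * d\<^sup>2 + 6 * d ^ 4) / 16"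
  have p4_mean: "has_mean (\<lambda>x. p x ^ 4) M"
  proof -
    \<comment> \<open>The coefficients of \<open>(\<sigma> (1 + u\<^sup>2) - 2 d u)\<^sup>4\<close> form a palindrome, since the base does.\<close>
    define a0 a1 a2 a3 a4 where "a0 = \<sigma> ^ 4" and "a1 = - 8 * \<sigma> ^ 3 * d"
      and "a2 = 4 * \<sigma> ^ 4 + 24 * \<sigma>\<^sup>2 * d\<^sup>2" and "a3 = - 24 * \<sigma> ^ 3 * d - 32 * \<sigma> * d ^ 3"
      and "a4 = 6 * \<sigma> ^ 4 + 48 * \<sigma>\<^sup>2 * d\<^sup>2 + 16 * d ^ 4"
    have "has_mean (\<lambda>x. 1 / 16 * (a0 * cos (2 * x) ^ 0 + a1 * cos (2 * x) ^ 1 + a2 * cos (2 * x) ^ 2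
        + a3 * cos (2 * x) ^ 3 + a4 * cos (2 * x) ^ 4 + a3 * cos (2 * x) ^ 5 + a2 * cos (2 * x) ^ 6
        + a1 * cos (2 * x) ^ 7 + a0 * cos (2 * x) ^ 8))
      (1 / 16 * (a0 * 1 + a1 * 0 + a2 * (1 / 2) + a3 * 0 + a4 * (3 / 8) + a3 * 0 + a2 * (5 / 16)
        + a1 * 0 + a0 * (35 / 128)))"
      by (intro has_mean_add has_mean_scale u)
    moreover have "p x ^ 4 = 1 / 16 * (a0 * cos (2 * x) ^ 0 + a1 * cos (2 * x) ^ 1 + a2 * cos (2 * x) ^ 2
        + a3 * cos (2 * x) ^ 3 + a4 * cos (2 * x) ^ 4 + a3 * cos (2 * x) ^ 5 + a2 * cos (2 * x) ^ 6
        + a1 * cos (2 * x) ^ 7 + a0 * cos (2 * x) ^ 8)" for x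
    proof -
      have "(\<sigma> * (1 + u\<^sup>2) - 2 * d * u) ^ 4 = a0 * u ^ 0 + a1 * u ^ 1 + a2 * u ^ 2 + a3 * u ^ 3
          + a4 * u ^ 4 + a3 * u ^ 5 + a2 * u ^ 6 + a1 * u ^ 7 + a0 * u ^ 8" for u
        unfolding a0_def a1_def a2_def a3_def a4_def power_0 power_one_right by algebra
      then show ?thesis unfolding p_def damping_double_angle by (simp add: power_divide)
    qed
    moreover have "1 / 16 * (a0 * 1 + a1 * 0 + a2 * (1 / 2) + a3 * 0 + a4 * (3 / 8) + a3 * 0 + a2 * (5 / 16)
        + a1 * 0 + a0 * (35 / 128)) = M"
      by (simp add: a0_def a1_def a2_def a4_def M_def field_simps)
    ultimately show ?thesis by (simp only:)
  qed
  have p2q_mean: "has_mean (\<lambda>x. (p x)\<^sup>2 * q x) 0"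
  proof (rule has_mean_derivative)
    show "((\<lambda>x. p x ^ 3 / 12) has_real_derivative (p x)\<^sup>2 * q x) (at x)" for x
      unfolding p_def q_def
      by (auto intro!: derivative_eq_intros damping_has_derivative_coupling simp: power2_eq_square)
    show "bounded (range (\<lambda>x. p x ^ 3 / 12))"
    proof (rule boundedI, clarify)
      fix x
      have "\<bar>p x\<bar> ^ 3 \<le> (\<bar>\<sigma> - d\<bar> + \<bar>\<sigma> + d\<bar>) ^ 3"
        unfolding p_def by (intro power_mono abs_damping_le) simp
      then show "norm (p x ^ 3 / 12) \<le> (\<bar>\<sigma> - d\<bar> + \<bar>\<sigma> + d\<bar>) ^ 3 / 12"
        by (simp add: power_abs)
    qed
  qed
  define m where "m = 3 * \<sigma> / 8 + (- 1) * (3 * \<sigma> / 4) + 2 / (3 * \<sigma>) *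
      (1 / (16 * \<Omega>\<^sup>2) * M + 3 / (2 * \<Omega>) * 0 + 9 * (d\<^sup>2 / 8 + \<sigma>\<^sup>2 / 32))"
  have "has_mean (\<lambda>x. 3 * \<sigma> / 8 + (- 1) * p x + 2 / (3 * \<sigma>) *
      (1 / (16 * \<Omega>\<^sup>2) * p x ^ 4 + 3 / (2 * \<Omega>) * ((p x)\<^sup>2 * q x) + 9 * (q x)\<^sup>2)) m"
    unfolding m_def
    by (intro has_mean_add has_mean_scale has_mean_const p_mean p4_mean p2q_mean q2_mean)
  moreover have "1 / (16 * \<Omega>\<^sup>2) * p x ^ 4 + 3 / (2 * \<Omega>) * ((p x)\<^sup>2 * q x) + 9 * (q x)\<^sup>2
      = ((p x)\<^sup>2 / (4 * \<Omega>) + 3 * q x)\<^sup>2" for x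
    using \<open>\<Omega> > 0\<close> by (simp add: field_simps power2_eq_square power4_eq_xxxx)
  ultimately have "has_mean (\<lambda>x. 3 * \<sigma> / 8 - p x + 2 / (3 * \<sigma>) * ((p x)\<^sup>2 / (4 * \<Omega>) + 3 * q x)\<^sup>2) m"
    by (simp only: mult_minus1 diff_conv_add_uminus)
  moreover have "m < 0"
  proof -
    define A D where "A = \<sigma>\<^sup>2" and "D = d\<^sup>2"
    have AD: "0 < A" "0 \<le> D" "16 * D \<le> A" using d \<open>\<sigma> > 0\<close> by (simp_all add: A_def D_def)
    \<comment> \<open>\<open>9 / 32 * (\<sigma>\<^sup>2 - 4 d\<^sup>2)\<close> is what \<open>9 \<sigma>\<^sup>2 / 16\<close> leaves after the mean of \<open>9 q\<^sup>2\<close> is subtracted.\<close>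
    have pos: "0 < 9 / 32 * (\<sigma>\<^sup>2 - 4 * d\<^sup>2)"
    proof -
      have "0 < 9 / 32 * (A - 4 * D)" using AD by simp
      then show ?thesis unfolding A_def D_def .
    qed
    have "0 < A * A" "0 \<le> A * D" using AD by simp_all
    moreover have "16 * (D * D) \<le> A * D"
      using mult_right_mono[OF AD(3,2)] unfolding mult.assoc .
    ultimately have "867 / 128 * (A * A) + 75 / 2 * (A * D) + 6 * (D * D)
        < 8 * (A * A) + 96 * (A * D) - 512 * (D * D)"
      by linarith
    also have "\<dots> = 8 * ((A + 16 * D) * (A - 4 * D))" by (simp add: algebra_simps)
    also have "867 / 128 * (A * A) + 75 / 2 * (A * D) + 6 * (D * D) = 16 * M"
      by (simp add: M_def A_def D_def power2_eq_square power4_eq_xxxx)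
    finally have "16 * M < 8 * ((\<sigma>\<^sup>2 + 16 * d\<^sup>2) * (\<sigma>\<^sup>2 - 4 * d\<^sup>2))"
      unfolding A_def D_def .
    also have "\<dots> \<le> 8 * (9 * \<Omega>\<^sup>2 * (\<sigma>\<^sup>2 - 4 * d\<^sup>2))"
      using \<Omega> pos by (intro mult_left_mono mult_right_mono) auto
    finally have "M < 9 / 32 * (\<sigma>\<^sup>2 - 4 * d\<^sup>2) * (16 * \<Omega>\<^sup>2)"
      by (simp add: algebra_simps)
    then have "M / (16 * \<Omega>\<^sup>2) < 9 / 32 * (\<sigma>\<^sup>2 - 4 * d\<^sup>2)"
      using \<open>\<Omega> > 0\<close> by (subst pos_divide_less_eq) simp_all
    then have "1 / (16 * \<Omega>\<^sup>2) * M + 9 * (d\<^sup>2 / 8 + \<sigma>\<^sup>2 / 32) < 9 / 16 * \<sigma>\<^sup>2" by simp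
    then have "2 / (3 * \<sigma>) * (1 / (16 * \<Omega>\<^sup>2) * M + 9 * (d\<^sup>2 / 8 + \<sigma>\<^sup>2 / 32)) < 2 / (3 * \<sigma>) * (9 / 16 * \<sigma>\<^sup>2)"
      using \<open>\<sigma> > 0\<close> by (intro mult_strict_left_mono) auto
    also have "\<dots> = 3 * \<sigma> / 8" using \<open>\<sigma> > 0\<close> by (simp add: field_simps power2_eq_square)
    finally show ?thesis by (simp add: m_def)
  qed
  ultimately show ?thesis by blast
qed

section \<open>Exponential stability of the bracket system\<close>

lemma bracket_system_lipschitz:
  "norm (bracket_system c1 c2 \<Omega> p t v - bracket_system c1 c2 \<Omega> p t w) \<le> (\<bar>c1\<bar> + \<bar>c2\<bar>) * norm (v - w)"
proof -
  obtain x y x' y' where vw: "v = (x, y)" "w = (x', y')" by fastforce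
  define C S where "C = cos (\<Omega> * t)" and "S = sin (\<Omega> * t)"
  define k where "k = c1 * (x - x') * C ^ 3 + c2 * (y - y') * S ^ 3"
  have "bracket_system c1 c2 \<Omega> p t v - bracket_system c1 c2 \<Omega> p t w = (- C * k, - S * k)"
    by (simp add: vw bracket_system_def k_def C_def S_def algebra_simps)
  also have "norm \<dots> = \<bar>k\<bar>"
  proof -
    have "(C * k)\<^sup>2 + (S * k)\<^sup>2 = k\<^sup>2"
      using sin_cos_squared_add[of "\<Omega> * t"] unfolding C_def S_def by algebra
    then show ?thesis by (simp add: norm_Pair)
  qed
  also have "\<bar>k\<bar> \<le> \<bar>c1\<bar> * norm (v - w) * 1 + \<bar>c2\<bar> * norm (v - w) * 1"
  proof -
    have "\<bar>c1 * (x - x') * C ^ 3\<bar> \<le> \<bar>c1\<bar> * norm (v - w) * 1"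
      unfolding abs_mult power_abs using norm_fst_le[of "x - x'" "y - y'"]
      by (intro mult_mono power_le_one) (auto simp: vw C_def)
    moreover have "\<bar>c2 * (y - y') * S ^ 3\<bar> \<le> \<bar>c2\<bar> * norm (v - w) * 1"
      unfolding abs_mult power_abs using norm_snd_le[of "y - y'" "x - x'"]
      by (intro mult_mono power_le_one) (auto simp: vw S_def)
    ultimately show ?thesis unfolding k_def by linarith
  qed
  finally show ?thesis by (simp add: algebra_simps)
qed

lemma bracket_system_at_target: "bracket_system c1 c2 \<Omega> p t p = 0"
  by (cases p) (simp add: bracket_system_def zero_prod_def)

lemma bracket_system_solution_exists:
  "\<exists>X. solves_ode_on (bracket_system c1 c2 \<Omega> p) {t0..} X \<and> X t0 = x0"
proof (rule global_solution_exists[where xe = p])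
  show "continuous_on UNIV (\<lambda>(t, x). bracket_system c1 c2 \<Omega> p t x)"
    unfolding bracket_system_def by (auto intro!: continuous_intros simp: split_beta)
  show "norm (bracket_system c1 c2 \<Omega> p t v - bracket_system c1 c2 \<Omega> p t w)
      \<le> (\<bar>c1\<bar> + \<bar>c2\<bar> + 1) * norm (v - w)" for t v w
    using bracket_system_lipschitz[of c1 c2 \<Omega> p t v w] norm_ge_zero[of "v - w"]
    unfolding distrib_right by linarith
qed (auto simp: bracket_system_at_target)

definition energy :: "real \<Rightarrow> real \<Rightarrow> real \<Rightarrow> real \<times> real \<Rightarrow> real \<Rightarrow> real"
  where "energy c1 c2 \<Omega> v t =
    (let r = cos (\<Omega> * t) * fst v + sin (\<Omega> * t) * snd v;
         s = cos (\<Omega> * t) * snd v - sin (\<Omega> * t) * fst v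
     in (\<Omega> * s)\<^sup>2 + (damping c1 c2 (\<Omega> * t) * s / 2 - \<Omega> * r)\<^sup>2)"

lemma energy_equivalent_to_norm:
  fixes c1 c2 \<Omega> :: real
  defines "P \<equiv> \<bar>c1\<bar> + \<bar>c2\<bar>"
  shows "2 * \<Omega> ^ 4 * (norm v)\<^sup>2 \<le> (6 * \<Omega>\<^sup>2 + P\<^sup>2) * energy c1 c2 \<Omega> v t"
    and "energy c1 c2 \<Omega> v t \<le> (2 * \<Omega>\<^sup>2 + P\<^sup>2) * (norm v)\<^sup>2"
proof -
  define r s where "r = cos (\<Omega> * t) * fst v + sin (\<Omega> * t) * snd v"
    and "s = cos (\<Omega> * t) * snd v - sin (\<Omega> * t) * fst v"
  have "r\<^sup>2 + s\<^sup>2 = ((fst v)\<^sup>2 + (snd v)\<^sup>2) * (sin (\<Omega> * t) ^ 2 + cos (\<Omega> * t) ^ 2)"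
    unfolding r_def s_def by algebra
  then have n: "r\<^sup>2 + s\<^sup>2 = (norm v)\<^sup>2" by (cases v) (simp add: norm_Pair)
  have e: "energy c1 c2 \<Omega> v t = (\<Omega> * s)\<^sup>2 + (damping c1 c2 (\<Omega> * t) * s / 2 - \<Omega> * r)\<^sup>2"
    by (simp add: energy_def Let_def r_def s_def)
  show "2 * \<Omega> ^ 4 * (norm v)\<^sup>2 \<le> (6 * \<Omega>\<^sup>2 + P\<^sup>2) * energy c1 c2 \<Omega> v t"
    and "energy c1 c2 \<Omega> v t \<le> (2 * \<Omega>\<^sup>2 + P\<^sup>2) * (norm v)\<^sup>2"
    using energy_norm_equivalence[OF abs_damping_le] unfolding e n[symmetric] P_def by blast+
qed

text \<open>
  The energy of every solution decays like \<open>exp (m (t - t0))\<close> with the negative mean rate \<open>m\<close>. The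
  energy is comparable to the squared norm of the error, hence the exponent \<open>m / 2\<close> for the norm.
  The system is linear in the error, so the radius \<open>1\<close> of the ball of initial values is arbitrary.
\<close>
lemma exponentially_stable_of_frequency_bound:
  fixes \<sigma> d \<Omega> :: real
  assumes "\<sigma> > 0" "\<Omega> > 0" and "16 * d\<^sup>2 \<le> \<sigma>\<^sup>2" and "\<sigma>\<^sup>2 + 16 * d\<^sup>2 \<le> 9 * \<Omega>\<^sup>2"
  shows "exponentially_stable (bracket_system (\<sigma> - d) (\<sigma> + d) \<Omega> p) p"
proof -
  define c1 c2 where "c1 = \<sigma> - d" and "c2 = \<sigma> + d"
  define f where "f = bracket_system c1 c2 \<Omega> p"
  define h where "h \<theta> = 3 * \<sigma> / 8 - damping c1 c2 \<theta>
      + 2 / (3 * \<sigma>) * ((damping c1 c2 \<theta>)\<^sup>2 / (4 * \<Omega>) + 3 * coupling c1 c2 \<theta>)\<^sup>2" for \<theta>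
  obtain m where "m < 0" and hm: "has_mean h m"
    using rate_has_negative_mean[OF assms] unfolding h_def c1_def c2_def by blast
  obtain K where "K > 0" and K: "\<And>V g t0 t.
     (\<And>\<tau>. \<tau> \<ge> t0 \<Longrightarrow> (V has_real_derivative g \<tau>) (at \<tau> within {t0..})) \<Longrightarrow>
     (\<And>\<tau>. \<tau> \<ge> t0 \<Longrightarrow> g \<tau> \<le> h (\<Omega> * \<tau>) * V \<tau>) \<Longrightarrow> V t0 \<ge> 0 \<Longrightarrow> t \<ge> t0 \<Longrightarrow>
     V t \<le> K * V t0 * exp (m * (t - t0))"
    by (rule gronwall_of_mean_rate[OF hm \<open>\<Omega> > 0\<close>]) blast
  define P where "P = \<bar>c1\<bar> + \<bar>c2\<bar>"
  define a b where "a = 6 * \<Omega>\<^sup>2 + P\<^sup>2" and "b = 2 * \<Omega>\<^sup>2 + P\<^sup>2"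
  have ab: "a > 0" "b > 0" using \<open>\<Omega> > 0\<close> by (auto simp: a_def b_def add_pos_nonneg)
  define N where "N = a * K * b / (2 * \<Omega> ^ 4)"
  have "N > 0" using ab \<open>K > 0\<close> \<open>\<Omega> > 0\<close> by (simp add: N_def)
  have decay: "norm (X t - p) \<le> sqrt N * norm (X t0 - p) * exp (- (- m / 2) * (t - t0))"
    if X: "solves_ode_on f {t0..} X" and "t \<ge> t0" for X t0 t
  proof -
    define x y where "x \<tau> = fst (X \<tau> - p)" and "y \<tau> = snd (X \<tau> - p)" for \<tau>
    define w where "w \<tau> = c1 * x \<tau> * cos (\<Omega> * \<tau>) ^ 3 + c2 * y \<tau> * sin (\<Omega> * \<tau>) ^ 3" for \<tau>
    define V where "V \<tau> = energy c1 c2 \<Omega> (X \<tau> - p) \<tau>" for \<tau>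
    have X': "((\<lambda>\<tau>. X \<tau> - p) has_vector_derivative (- cos (\<Omega> * \<tau>) * w \<tau>, - sin (\<Omega> * \<tau>) * w \<tau>))
        (at \<tau> within {t0..})" if "\<tau> \<ge> t0" for \<tau>
    proof -
      have "f \<tau> (X \<tau>) = (- cos (\<Omega> * \<tau>) * w \<tau>, - sin (\<Omega> * \<tau>) * w \<tau>)"
        by (simp add: f_def bracket_system_def w_def x_def y_def split_beta)
      moreover have "(X has_vector_derivative f \<tau> (X \<tau>)) (at \<tau> within {t0..})"
        using X that by (simp add: solves_ode_on_def)
      ultimately show ?thesis by (auto intro!: derivative_eq_intros)
    qed
    have x': "(x has_real_derivative - cos (\<Omega> * \<tau>) * w \<tau>) (at \<tau> within {t0..})" if "\<tau> \<ge> t0" for \<tau>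
      using bounded_linear.has_vector_derivative[OF bounded_linear_fst X'[OF that]]
      by (simp add: x_def[abs_def] has_real_derivative_iff_has_vector_derivative)
    have y': "(y has_real_derivative - sin (\<Omega> * \<tau>) * w \<tau>) (at \<tau> within {t0..})" if "\<tau> \<ge> t0" for \<tau>
      using bounded_linear.has_vector_derivative[OF bounded_linear_snd X'[OF that]]
      by (simp add: y_def[abs_def] has_real_derivative_iff_has_vector_derivative)
    define r s where "r \<tau> = cos (\<Omega> * \<tau>) * x \<tau> + sin (\<Omega> * \<tau>) * y \<tau>"
      and "s \<tau> = cos (\<Omega> * \<tau>) * y \<tau> - sin (\<Omega> * \<tau>) * x \<tau>" for \<tau>
    define z where "z \<tau> = damping c1 c2 (\<Omega> * \<tau>) * s \<tau> / 2 - \<Omega> * r \<tau>" for \<tau>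
    have V: "V \<tau> = (\<Omega> * s \<tau>)\<^sup>2 + (z \<tau>)\<^sup>2" for \<tau>
      by (simp add: V_def energy_def Let_def z_def r_def s_def x_def y_def)
    define g where "g \<tau> = - damping c1 c2 (\<Omega> * \<tau>) * V \<tau> + 2 * s \<tau> * z \<tau> *
        ((damping c1 c2 (\<Omega> * \<tau>))\<^sup>2 / 4 + 3 * \<Omega> * coupling c1 c2 (\<Omega> * \<tau>))" for \<tau>
    have "V t \<le> K * V t0 * exp (m * (t - t0))"
    proof (rule K[of t0 V g])
      fix \<tau> assume "\<tau> \<ge> t0"
      show "(V has_real_derivative g \<tau>) (at \<tau> within {t0..})"
        using energy_has_derivative[OF x'[OF \<open>\<tau> \<ge> t0\<close>, unfolded w_def] y'[OF \<open>\<tau> \<ge> t0\<close>, unfolded w_def]]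
        unfolding V[abs_def] g_def z_def r_def s_def .
      show "g \<tau> \<le> h (\<Omega> * \<tau>) * V \<tau>"
        unfolding g_def h_def V using \<open>\<sigma> > 0\<close> \<open>\<Omega> > 0\<close> by (rule quadratic_rate_bound)
    qed (use \<open>t \<ge> t0\<close> in \<open>auto simp: V\<close>)
    also have "\<dots> \<le> K * (b * (norm (X t0 - p))\<^sup>2) * exp (m * (t - t0))"
      using energy_equivalent_to_norm(2)[of c1 c2 \<Omega> "X t0 - p" t0] \<open>K > 0\<close>
      by (intro mult_right_mono mult_left_mono) (auto simp: V_def b_def P_def)
    finally have "a * V t \<le> a * (K * (b * (norm (X t0 - p))\<^sup>2) * exp (m * (t - t0)))"
      using \<open>a > 0\<close> by simp
    then have "2 * \<Omega> ^ 4 * (norm (X t - p))\<^sup>2 \<le> a * (K * (b * (norm (X t0 - p))\<^sup>2) * exp (m * (t - t0)))"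
      using energy_equivalent_to_norm(1)[of \<Omega> "X t - p" c1 c2 t] by (simp add: V_def a_def P_def)
    then have "(norm (X t - p))\<^sup>2 \<le> N * (norm (X t0 - p))\<^sup>2 * exp (m * (t - t0))"
      using \<open>\<Omega> > 0\<close> by (simp add: N_def field_simps)
    also have "\<dots> = (sqrt N * norm (X t0 - p) * exp (- (- m / 2) * (t - t0)))\<^sup>2"
      using \<open>N > 0\<close> by (simp add: power_mult_distrib flip: exp_double)
    finally show ?thesis
      by (rule power2_le_imp_le) (use \<open>N > 0\<close> in simp)
  qed
  have "\<forall>t0 x0. norm (x0 - p) < 1 \<longrightarrow>
      (\<exists>X. solves_ode_on f {t0..} X \<and> X t0 = x0) \<and>
      (\<forall>X. solves_ode_on f {t0..} X \<and> X t0 = x0 \<longrightarrow>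
        (\<forall>t\<ge>t0. norm (X t - p) \<le> sqrt N * norm (x0 - p) * exp (- (- m / 2) * (t - t0))))"
    using decay bracket_system_solution_exists unfolding f_def by blast
  moreover have "sqrt N > 0" "- m / 2 > 0" "(1 :: real) > 0"
    using \<open>N > 0\<close> \<open>m < 0\<close> by simp_all
  moreover have "equilibrium f p"
    by (simp add: equilibrium_def f_def bracket_system_at_target)
  ultimately show ?thesis
    unfolding exponentially_stable_def f_def c1_def c2_def by blast
qed

text \<open>
  Here \<open>c\<close> is the smaller and \<open>e\<close> the larger of the two gains, so both cases of the theorem are covered.
  The condition \<open>3 e / 5 < c\<close> says \<open>4 d < \<sigma>\<close>, which makes the denominator \<open>12 \<sigma> (\<sigma> - 4 d)\<close> positive; after
  clearing it, the numerator exceeds \<open>(\<sigma> + 4 d) / 3\<close> times the denominator by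
  \<open>4 d (4 \<sigma>\<^sup>2 + d (17 \<sigma> - 6 d))\<close>.
\<close>
lemma frequency_bound_of_threshold:
  fixes c e \<Omega> :: real
  assumes "c > 0" and ce: "3 * e / 5 < c" "c \<le> e"
    and \<Omega>: "\<Omega> > 2 * c * (3 * e - c) * (2 * e - c) / (16 * c ^ 2 - (3 * e - c) ^ 2)"
  defines "\<sigma> \<equiv> (c + e) / 2" and "d \<equiv> (e - c) / 2"
  shows "\<sigma> > 0" "\<Omega> > 0" "16 * d\<^sup>2 \<le> \<sigma>\<^sup>2" "\<sigma>\<^sup>2 + 16 * d\<^sup>2 \<le> 9 * \<Omega>\<^sup>2"
proof -
  have c: "c = \<sigma> - d" and e: "e = \<sigma> + d" by (simp_all add: \<sigma>_def d_def field_simps)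
  have d: "0 \<le> d" "4 * d < \<sigma>" using ce by (simp_all add: \<sigma>_def d_def)
  show "\<sigma> > 0" using d by linarith
  have "(4 * d)\<^sup>2 \<le> \<sigma>\<^sup>2" using d by (intro power_mono) auto
  then show "16 * d\<^sup>2 \<le> \<sigma>\<^sup>2" by (simp add: power_mult_distrib)
  have den: "16 * c ^ 2 - (3 * e - c) ^ 2 = 12 * \<sigma> * (\<sigma> - 4 * d)"
    unfolding c e by (simp add: power2_eq_square algebra_simps)
  have num: "2 * c * (3 * e - c) * (2 * e - c) = 4 * (\<sigma> - d) * (\<sigma> + 2 * d) * (\<sigma> + 3 * d)"
    unfolding c e by (simp add: algebra_simps)
  have "(\<sigma> + 4 * d) / 3 * (12 * \<sigma> * (\<sigma> - 4 * d)) \<le> 4 * (\<sigma> - d) * (\<sigma> + 2 * d) * (\<sigma> + 3 * d)"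
  proof -
    have "0 \<le> 4 * d * (4 * \<sigma>\<^sup>2 + d * (17 * \<sigma> - 6 * d))"
      using d by (intro mult_nonneg_nonneg add_nonneg_nonneg) auto
    also have "\<dots> = 4 * (\<sigma> - d) * (\<sigma> + 2 * d) * (\<sigma> + 3 * d) - (\<sigma> + 4 * d) / 3 * (12 * \<sigma> * (\<sigma> - 4 * d))"
      by (simp add: power2_eq_square field_simps)
    finally show ?thesis by simp
  qed
  moreover have "0 < 12 * \<sigma> * (\<sigma> - 4 * d)" using d \<open>\<sigma> > 0\<close> by simp
  ultimately have "(\<sigma> + 4 * d) / 3 \<le> 4 * (\<sigma> - d) * (\<sigma> + 2 * d) * (\<sigma> + 3 * d) / (12 * \<sigma> * (\<sigma> - 4 * d))"
    by (subst pos_le_divide_eq)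
  also have "\<dots> < \<Omega>" using \<Omega> unfolding den num .
  finally have b: "\<sigma> + 4 * d < 3 * \<Omega>" by simp
  then show "\<Omega> > 0" using d by linarith
  have "\<sigma>\<^sup>2 + 16 * d\<^sup>2 \<le> (\<sigma> + 4 * d)\<^sup>2" using d by (simp add: power2_sum power_mult_distrib)
  also have "\<dots> \<le> (3 * \<Omega>)\<^sup>2" using b d by (intro power_mono) auto
  finally show "\<sigma>\<^sup>2 + 16 * d\<^sup>2 \<le> 9 * \<Omega>\<^sup>2" by (simp add: power_mult_distrib)
qed

theorem theorem1:
  fixes C1 C2 a c \<Omega> xd yd c1 c2 :: real
  assumes "C1 > 0" and "C2 > 0" and "a > 0" and "c > 0"
    and "c1 = fact 4 * c * a ^ 3 * C1"
    and "c2 = fact 4 * c * a ^ 3 * C2"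
    and "(c1 \<in> {3 * c2 / 5 <.. c2} \<and>
          \<Omega> > 2 * c1 * (3 * c2 - c1) * (2 * c2 - c1) / (16 * c1 ^ 2 - (3 * c2 - c1) ^ 2)) \<or>
         (c2 \<in> {3 * c1 / 5 <.. c1} \<and>
          \<Omega> > 2 * c2 * (3 * c1 - c2) * (2 * c1 - c2) / (16 * c2 ^ 2 - (3 * c1 - c2) ^ 2))"
  shows "exponentially_stable (bracket_system c1 c2 \<Omega> (xd, yd)) (xd, yd)"
proof -
  have pos: "c1 > 0" "c2 > 0" using assms(1-6) by simp_all
  define \<sigma> d where "\<sigma> = (c1 + c2) / 2" and "d = (c2 - c1) / 2"
  have c: "c1 = \<sigma> - d" "c2 = \<sigma> + d" by (simp_all add: \<sigma>_def d_def field_simps)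
  \<comment> \<open>Exchanging \<open>c1\<close> and \<open>c2\<close> only changes the sign of \<open>d\<close>.\<close>
  have sym: "((c1 - c2) / 2)\<^sup>2 = d\<^sup>2" "(c2 + c1) / 2 = \<sigma>"
    by (simp_all add: d_def \<sigma>_def power_divide power2_commute)
  from assms(7) have "\<sigma> > 0 \<and> \<Omega> > 0 \<and> 16 * d\<^sup>2 \<le> \<sigma>\<^sup>2 \<and> \<sigma>\<^sup>2 + 16 * d\<^sup>2 \<le> 9 * \<Omega>\<^sup>2"
  proof
    assume "c1 \<in> {3 * c2 / 5 <.. c2} \<and>
      \<Omega> > 2 * c1 * (3 * c2 - c1) * (2 * c2 - c1) / (16 * c1 ^ 2 - (3 * c2 - c1) ^ 2)"
    then show ?thesis
      using frequency_bound_of_threshold[OF pos(1), of c2 \<Omega>] by (simp add: \<sigma>_def d_def)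
  next
    assume "c2 \<in> {3 * c1 / 5 <.. c1} \<and>
      \<Omega> > 2 * c2 * (3 * c1 - c2) * (2 * c1 - c2) / (16 * c2 ^ 2 - (3 * c1 - c2) ^ 2)"
    then show ?thesis
      using frequency_bound_of_threshold[OF pos(2), of c1 \<Omega>] unfolding sym by simp
  qed
  then show ?thesis
    unfolding c by (intro exponentially_stable_of_frequency_bound) auto
qed

end
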